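(* Let $\mathbb G$ be a group of Heisenberg type and let $S\in\mathscr S(\mathfrak h)$. Given a function $f:\mathbb G\to\mathbb R$, set $g(z,\sigma)=f(Sz,\sigma)$. One has $$\Delta_H g(z,\sigma)=\Delta_H f(Sz,\sigma),$$ and also $$\Delta_{H,\infty}g(z,\sigma)=\Delta_{H,\infty}f(Sz,\sigma).$$ Finally, for any $1<p<\infty$, $$\Delta_{H,p}g(z,\sigma)=\Delta_{H,p}f(Sz,\sigma).$$ Here the right-hand sides denote the functions $\Delta_Hf$, $\Delta_{H,\infty}f$, $\Delta_{H,p}f$ evaluated at the point $(Sz,\sigma)$.
   Context: A group of Heisenberg type is a simply connected Lie group $\mathbb G$ whose Lie algebra is $\mathfrak g=\mathfrak h\oplus\mathfrak v$ with $[\mathfrak h,\mathfrak h]=\mathfrak v$, $[\mathfrak h,\mathfrak v]=\{0\}$, equipped with an inner product with $\mathfrak h\perp\mathfrak v$, such that the linear map $J:\mathfrak v\to\operatorname{End}(\mathfrak h)$ defined by $\langle J(\sigma)z,z'\rangle=\langle[z,z'],\sigma\rangle$ satisfies $J(\sigma)^2=-|\sigma|^2I_{\mathfrak h}$ for all $\sigma\in\mathfrak v$. Let $m=\dim\mathfrak h$, $k=\dim\mathfrak v$, and let $\{e_i\}_{i=1}^m$, $\{\varepsilon_\ell\}_{\ell=1}^k$ be orthonormal bases of $\mathfrak h$ and $\mathfrak v$. Points of $\mathbb G$ are written in logarithmic coordinates $x=(z,\sigma)$, $z\in\mathfrak h$, $\sigma\in\mathfrak v$. The left-invariant horizontal vector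 fields are $X_i=\partial_{z_i}+\frac12\sum_{\ell=1}^k\langle J(\varepsilon_\ell)z,e_i\rangle\partial_{\sigma_\ell}$, $i=1,\dots,m$. Set $\nabla_Hf=\sum_{i=1}^m X_if\,X_i$, $\langle\nabla_HF,\nabla_Hf\rangle=\sum_{i=1}^m X_iF\,X_if$, $|\nabla_Hf|^2=\sum_{i=1}^m(X_if)^2$, and $$\Delta_Hf=\sum_{i=1}^mX_i^2f,\qquad \Delta_{H,\infty}f=\tfrac12\langle\nabla_H(|\nabla_Hf|^2),\nabla_Hf\rangle,\qquad \Delta_{H,p}f=\sum_{i=1}^mX_i\big(|\nabla_Hf|^{p-2}X_if\big).$$ The $J$-invariant orthogonal group of $\mathfrak h$ is $\mathscr S(\mathfrak h)=\{S\in O(\mathfrak h): SJ(\sigma)=J(\sigma)S\ \text{for every }\sigma\in\mathfrak v\}$, where $O(\mathfrak h)$ is the orthogonal group of $\mathfrak h$.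
   Formalization: The function f is assumed twice differentiable at (Sz,σ); for 1<p<2, where the horizontal gradient of f vanishes at (Sz,σ), the fields |∇_H f|^{p-2}X_i f (set to 0 at critical points) are also assumed differentiable there. *)

theory Defs
  imports "HOL-Analysis.Analysis"
begin

text \<open>
  The Lie algebra is the orthogonal sum of two Euclidean spaces \<open>'h\<close> (horizontal layer) and
  \<open>'v\<close> (vertical layer), modelled as \<open>'h \<times> 'v\<close> with its product inner product; the layers are
  \<open>UNIV \<times> {0}\<close> and \<open>{0} \<times> UNIV\<close>. The simply connected group is identified with its Lie algebra
  through the exponential map (logarithmic coordinates), so functions on the group are functions
  on \<open>'h \<times> 'v\<close>.
\<close>

definition J_map :: "('h::euclidean_space \<times> 'v::euclidean_space \<Rightarrow> 'h \<times> 'v \<Rightarrow> 'h \<times> 'v)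
    \<Rightarrow> 'v \<Rightarrow> 'h \<Rightarrow> 'h" where
  "J_map br \<sigma> z = (THE w. \<forall>z'. w \<bullet> z' = br (z, 0) (z', 0) \<bullet> (0, \<sigma>))"

locale heisenberg_type =
  fixes br :: "'h::euclidean_space \<times> 'v::euclidean_space \<Rightarrow> 'h \<times> 'v \<Rightarrow> 'h \<times> 'v"
  assumes bilinear_br: "bilinear br"
    and br_self: "br x x = 0"
    and jacobi: "br x (br y w) + br y (br w x) + br w (br x y) = 0"
    and br_hh: "span {br (z, 0) (z', 0) | z z'. True} = {0} \<times> UNIV"
    and br_hv: "br (z, 0) (0, \<sigma>) = 0"
    and J_map_square: "J_map br \<sigma> (J_map br \<sigma> z) = - (norm \<sigma>)\<^sup>2 *\<^sub>R z"

definition orthonormal_basis :: "'a::euclidean_space set \<Rightarrow> bool" where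
  "orthonormal_basis B \<longleftrightarrow> pairwise orthogonal B \<and> (\<forall>b\<in>B. norm b = 1) \<and> span B = UNIV"

definition J_orthogonal_group :: "('h::euclidean_space \<times> 'v::euclidean_space \<Rightarrow> 'h \<times> 'v \<Rightarrow> 'h \<times> 'v)
    \<Rightarrow> ('h \<Rightarrow> 'h) set" where
  "J_orthogonal_group br =
     {S. orthogonal_transformation S \<and> (\<forall>\<sigma>. S \<circ> J_map br \<sigma> = J_map br \<sigma> \<circ> S)}"

definition partial_deriv :: "'a::real_normed_vector \<Rightarrow> ('a \<Rightarrow> real) \<Rightarrow> 'a \<Rightarrow> real" where
  "partial_deriv d u x = deriv (\<lambda>t. u (x + t *\<^sub>R d)) 0"

text \<open>
  In what follows \<open>E\<close> and \<open>V\<close> are orthonormal bases of the two layers, and the field \<open>X\<^sub>i\<close> is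
  indexed by the basis vector \<open>e \<in> E\<close> itself.
\<close>

definition X_field :: "('h::euclidean_space \<times> 'v::euclidean_space \<Rightarrow> 'h \<times> 'v \<Rightarrow> 'h \<times> 'v)
    \<Rightarrow> 'v set \<Rightarrow> 'h \<Rightarrow> ('h \<times> 'v \<Rightarrow> real) \<Rightarrow> 'h \<times> 'v \<Rightarrow> real" where
  "X_field br V e u x = partial_deriv (e, 0) u x
     + 1/2 * (\<Sum>\<epsilon>\<in>V. (J_map br \<epsilon> (fst x) \<bullet> e) * partial_deriv (0, \<epsilon>) u x)"

definition hgrad_inner :: "('h::euclidean_space \<times> 'v::euclidean_space \<Rightarrow> 'h \<times> 'v \<Rightarrow> 'h \<times> 'v)
    \<Rightarrow> 'h set \<Rightarrow> 'v set \<Rightarrow> ('h \<times> 'v \<Rightarrow> real) \<Rightarrow> ('h \<times> 'v \<Rightarrow> real) \<Rightarrow> 'h \<times> 'v \<Rightarrow> real" where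
  "hgrad_inner br E V F f x = (\<Sum>e\<in>E. X_field br V e F x * X_field br V e f x)"

definition hgrad_norm :: "('h::euclidean_space \<times> 'v::euclidean_space \<Rightarrow> 'h \<times> 'v \<Rightarrow> 'h \<times> 'v)
    \<Rightarrow> 'h set \<Rightarrow> 'v set \<Rightarrow> ('h \<times> 'v \<Rightarrow> real) \<Rightarrow> 'h \<times> 'v \<Rightarrow> real" where
  "hgrad_norm br E V f x = sqrt (\<Sum>e\<in>E. (X_field br V e f x)\<^sup>2)"

definition hlaplacian :: "('h::euclidean_space \<times> 'v::euclidean_space \<Rightarrow> 'h \<times> 'v \<Rightarrow> 'h \<times> 'v)
    \<Rightarrow> 'h set \<Rightarrow> 'v set \<Rightarrow> ('h \<times> 'v \<Rightarrow> real) \<Rightarrow> 'h \<times> 'v \<Rightarrow> real" where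
  "hlaplacian br E V f x = (\<Sum>e\<in>E. X_field br V e (X_field br V e f) x)"

definition hinf_laplacian :: "('h::euclidean_space \<times> 'v::euclidean_space \<Rightarrow> 'h \<times> 'v \<Rightarrow> 'h \<times> 'v)
    \<Rightarrow> 'h set \<Rightarrow> 'v set \<Rightarrow> ('h \<times> 'v \<Rightarrow> real) \<Rightarrow> 'h \<times> 'v \<Rightarrow> real" where
  "hinf_laplacian br E V f x
     = 1/2 * hgrad_inner br E V (\<lambda>y. (hgrad_norm br E V f y)\<^sup>2) f x"

text \<open>
  Since \<open>0 powr a = 0\<close>, the components of \<open>|\<nabla>\<^sub>H f|\<^sup>p\<^sup>-\<^sup>2 \<nabla>\<^sub>H f\<close> vanish where \<open>\<nabla>\<^sub>H f\<close> does; for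
  \<open>p > 1\<close> this is the continuous extension to critical points.
\<close>

definition p_flux :: "('h::euclidean_space \<times> 'v::euclidean_space \<Rightarrow> 'h \<times> 'v \<Rightarrow> 'h \<times> 'v)
    \<Rightarrow> 'h set \<Rightarrow> 'v set \<Rightarrow> real \<Rightarrow> ('h \<times> 'v \<Rightarrow> real) \<Rightarrow> 'h \<Rightarrow> 'h \<times> 'v \<Rightarrow> real" where
  "p_flux br E V p f e x = hgrad_norm br E V f x powr (p - 2) * X_field br V e f x"

definition hp_laplacian :: "('h::euclidean_space \<times> 'v::euclidean_space \<Rightarrow> 'h \<times> 'v \<Rightarrow> 'h \<times> 'v)
    \<Rightarrow> 'h set \<Rightarrow> 'v set \<Rightarrow> real \<Rightarrow> ('h \<times> 'v \<Rightarrow> real) \<Rightarrow> 'h \<times> 'v \<Rightarrow> real" where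
  "hp_laplacian br E V p f x = (\<Sum>e\<in>E. X_field br V e (p_flux br E V p f e) x)"

text \<open>
  Pointwise twice (Frechet) differentiability; every function that is \<open>C\<^sup>2\<close> near \<open>x\<close> has it.
\<close>

definition twice_differentiable_at :: "('a::real_normed_vector \<Rightarrow> real) \<Rightarrow> 'a \<Rightarrow> bool" where
  "twice_differentiable_at f x \<longleftrightarrow>
     (\<exists>f' :: 'a \<Rightarrow> 'a \<Rightarrow>\<^sub>L real.
        (\<forall>\<^sub>F y in nhds x. (f has_derivative blinfun_apply (f' y)) (at y)) \<and>
        f' differentiable (at x))"

text \<open>The group law in logarithmic coordinates (Baker--Campbell--Hausdorff, step two).\<close>

definition group_mult :: "('h::euclidean_space \<times> 'v::euclidean_space \<Rightarrow> 'h \<times> 'v \<Rightarrow> 'h \<times> 'v)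
    \<Rightarrow> 'h \<times> 'v \<Rightarrow> 'h \<times> 'v \<Rightarrow> 'h \<times> 'v" where
  "group_mult br x y = x + y + (1/2) *\<^sub>R br x y"

lemma partial_deriv_eq:
  assumes "(u has_derivative D) (at x)"
  shows "partial_deriv d u x = D d"
proof -
  have g: "((\<lambda>t. x + t *\<^sub>R d) has_derivative (\<lambda>t. t *\<^sub>R d)) (at 0)"
    by (auto intro!: derivative_eq_intros)
  have "((\<lambda>t. u (x + t *\<^sub>R d)) has_derivative (\<lambda>t. D (t *\<^sub>R d))) (at 0)"
    using has_derivative_compose[OF g, of u D] assms by simp
  moreover have "D (t *\<^sub>R d) = D d * t" for t
    using linear_scale[OF has_derivative_linear[OF assms]] by simp
  ultimately have "((\<lambda>t. u (x + t *\<^sub>R d)) has_field_derivative D d) (at 0)"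
    by (simp add: has_field_derivative_def)
  then show ?thesis
    unfolding partial_deriv_def by (rule DERIV_imp_deriv)
qed

lemma orthonormal_basis_sum:
  assumes "orthonormal_basis B"
  shows "(\<Sum>b\<in>B. (x \<bullet> b) *\<^sub>R b) = x"
proof -
  have po: "pairwise orthogonal B" and "\<And>b. b \<in> B \<Longrightarrow> norm b = 1" and "x \<in> span B"
    using assms by (auto simp: orthonormal_basis_def)
  then show ?thesis
    using orthonormal_basis_expand pairwise_orthogonal_imp_finite by metis
qed

context heisenberg_type
begin

lemma linear_br: "linear (br x)" "linear (\<lambda>x. br x y)"
  using bilinear_br unfolding bilinear_def by blast+

lemma br_sym: "br x y = - br y x"
proof -
  have "br (x + y) (x + y) = 0"
    by (rule br_self)
  then have "br x y + br y x = 0"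
    unfolding linear_add[OF linear_br(1)] linear_add[OF linear_br(2)]
    by (simp add: br_self add.commute)
  then show ?thesis
    by (simp add: eq_neg_iff_add_eq_0)
qed

lemma br_vv: "br (0, \<sigma>) (0, \<tau>) = 0"
proof -
  have "(0, \<sigma>) \<in> span {br (z, 0) (z', 0) | z z'. True}"
    unfolding br_hh by simp
  then show ?thesis
  proof (induction rule: span_induct)
    case base
    show ?case
      by (rule subspaceI) (simp_all only: mem_Collect_eq linear_0[OF linear_br(2)]
          linear_add[OF linear_br(2)] linear_scale[OF linear_br(2)] add_0_right scaleR_zero_right)
  next
    case (step x)
    then obtain z z' where x: "x = br (z, 0) (z', 0)"
      by auto
    have "br (0, \<tau>) (z, 0) = 0"
      using br_sym[of "(0, \<tau>)" "(z, 0)"] by (simp add: br_hv)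
    then have "br (0, \<tau>) x = 0"
      using jacobi[of "(z, 0)" "(z', 0)" "(0, \<tau>)"]
      by (simp add: x br_hv linear_0[OF linear_br(1)])
    then show ?case
      using br_sym[of x] by simp
  qed
qed

lemma br_horizontal: "br (z, \<sigma>) (z', \<sigma>') = br (z, 0) (z', 0)"
proof -
  have "br (z, \<sigma>) (z', \<sigma>') = br ((z, 0) + (0, \<sigma>)) ((z', 0) + (0, \<sigma>'))"
    by simp
  also have "\<dots> = br (z, 0) (z', 0) + br (0, \<sigma>) (z', 0)"
    unfolding linear_add[OF linear_br(1)] linear_add[OF linear_br(2)]
    by (simp add: br_hv br_vv)
  also have "br (0, \<sigma>) (z', 0) = 0"
    using br_sym[of "(0, \<sigma>)"] by (simp add: br_hv)
  finally show ?thesis by simp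
qed

lemma fst_br: "fst (br x y) = 0"
proof -
  have "br (fst x, 0) (fst y, 0) \<in> span {br (z, 0) (z', 0) | z z'. True}"
    by (intro span_base) auto
  then have "fst (br (fst x, 0) (fst y, 0)) = 0"
    unfolding br_hh by auto
  then show ?thesis
    using br_horizontal[of "fst x" "snd x" "fst y" "snd y"] by simp
qed

lemma J_map_inner: "J_map br \<sigma> z \<bullet> z' = br (z, 0) (z', 0) \<bullet> (0, \<sigma>)"
proof -
  have lin: "linear (\<lambda>z'. br (z, 0) (z', 0))"
    using linear_compose[of "\<lambda>z'. (z', 0)" "br (z, 0)"] linear_br(1)
    by (simp add: o_def linear_iff)
  define w where "w = adjoint (\<lambda>z'. br (z, 0) (z', 0)) (0, \<sigma>)"
  have w: "w \<bullet> z' = br (z, 0) (z', 0) \<bullet> (0, \<sigma>)" for z'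
    using adjoint_works[OF lin] by (simp add: w_def inner_commute)
  have "J_map br \<sigma> z = w"
    unfolding J_map_def
  proof (rule the_equality)
    show "\<forall>z'. w \<bullet> z' = br (z, 0) (z', 0) \<bullet> (0, \<sigma>)"
      using w by blast
  next
    fix w' assume "\<forall>z'. w' \<bullet> z' = br (z, 0) (z', 0) \<bullet> (0, \<sigma>)"
    then have "w' \<bullet> z' = w \<bullet> z'" for z'
      using w by simp
    then show "w' = w"
      using vector_eq_rdot by blast
  qed
  then show ?thesis
    using w by simp
qed

text \<open>
  Where \<open>u\<close> is differentiable, \<open>X\<^sub>e u\<close> is the derivative along \<open>e + [x, e] / 2\<close>, the initial
  velocity of \<open>t \<mapsto> group_mult br x (t e, 0)\<close>; hence \<open>X\<^sub>e\<close> is left-invariant.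
\<close>

lemma X_field_eq:
  assumes V: "orthonormal_basis V" and u: "(u has_derivative D) (at x)"
  shows "X_field br V e u x = D ((e, 0) + (1/2) *\<^sub>R br x (e, 0))"
proof -
  have lin: "linear D"
    using u by (rule has_derivative_linear)
  define b where "b = snd (br x (e, 0))"
  have b: "br x (e, 0) = (0, b)"
    by (simp add: b_def prod_eq_iff fst_br)
  have J: "J_map br \<epsilon> (fst x) \<bullet> e = b \<bullet> \<epsilon>" for \<epsilon>
  proof -
    have "br (fst x, 0) (e, 0) = (0, b)"
      using br_horizontal[of "fst x" "snd x" e 0] b by simp
    then show ?thesis
      by (simp add: J_map_inner)
  qed
  have "(\<Sum>\<epsilon>\<in>V. (b \<bullet> \<epsilon>) * D (0, \<epsilon>)) = D (\<Sum>\<epsilon>\<in>V. (b \<bullet> \<epsilon>) *\<^sub>R (0, \<epsilon>))"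
    by (simp add: linear_sum[OF lin] linear_scale[OF lin] del: scaleR_Pair)
  also have "(\<Sum>\<epsilon>\<in>V. (b \<bullet> \<epsilon>) *\<^sub>R ((0::'h), \<epsilon>)) = (0, \<Sum>\<epsilon>\<in>V. (b \<bullet> \<epsilon>) *\<^sub>R \<epsilon>)"
    by (simp add: prod_eq_iff fst_sum snd_sum)
  also have "\<dots> = (0, b)"
    by (simp add: orthonormal_basis_sum[OF V])
  finally show ?thesis
    by (simp add: X_field_def partial_deriv_eq[OF u] J b linear_add[OF lin] linear_scale[OF lin]
        del: scaleR_Pair add_Pair)
qed

lemma X_field_left_invariant:
  assumes V: "orthonormal_basis V" and u: "u differentiable (at (group_mult br a x))"
  shows "X_field br V e (\<lambda>y. u (group_mult br a y)) x = X_field br V e u (group_mult br a x)"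
proof -
  obtain D where D: "(u has_derivative D) (at (group_mult br a x))"
    using u by (auto simp: differentiable_def)
  have "bounded_linear (br a)"
    using linear_br(1) by (simp add: linear_conv_bounded_linear)
  then have "(br a has_derivative br a) (at x)"
    by (rule bounded_linear_imp_has_derivative)
  then have m: "(group_mult br a has_derivative (\<lambda>v. v + (1/2) *\<^sub>R br a v)) (at x)"
    unfolding group_mult_def by (auto intro!: derivative_eq_intros)
  have v: "br y (0, \<tau>) = 0" for y \<tau>
    using br_horizontal[of "fst y" "snd y" 0 \<tau>] linear_0[OF linear_br(1)] by (simp add: zero_prod_def)
  have w: "br x (e, 0) = (0, snd (br x (e, 0)))" for x e
    by (simp add: prod_eq_iff fst_br)
  have "br a (br x (e, 0)) = 0"
    by (subst w) (rule v)
  moreover have "br (br a x) (e, 0) = 0"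
    using br_sym[of "br a x" "(e, 0)"] v[of "(e, 0)" "snd (br a x)"]
    by (metis fst_br neg_equal_0_iff_equal prod.collapse)
  ultimately have "(e, 0) + (1/2) *\<^sub>R br x (e, 0) + (1/2) *\<^sub>R br a ((e, 0) + (1/2) *\<^sub>R br x (e, 0))
      = (e, 0) + (1/2) *\<^sub>R br (group_mult br a x) (e, 0)"
    unfolding group_mult_def linear_add[OF linear_br(1)] linear_add[OF linear_br(2)]
      linear_scale[OF linear_br(1)] linear_scale[OF linear_br(2)]
    by (simp only: scaleR_add_right scaleR_zero_right add_0_right add.assoc add.commute add.left_commute)
  then show ?thesis
    using X_field_eq[OF V has_derivative_compose[OF m D]] X_field_eq[OF V D] by metis
qed

end

end

theory Submission
  imports Defs
begin

text \<open>
  The map \<open>\<phi> (w, \<tau>) = (S w, \<tau>)\<close> preserves the bracket, so \<open>X\<^sub>e (u \<circ> \<phi>) = (X\<^sub>S\<^sub>e u) \<circ> \<phi>\<close> wherever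
  \<open>u\<close> is differentiable. Hence \<open>\<phi>\<close> rotates horizontal gradients by \<open>S\<close>, preserving their inner
  products, and the horizontal divergence, being the trace of a linear map of the horizontal layer,
  does not change when the basis \<open>E\<close> is replaced by its image under \<open>S\<close>. All three operators are
  built from these; the flux \<open>|U|\<^sup>p\<^sup>-\<^sup>2 U\<close> of a differentiable \<open>U\<close> is differentiable also at the
  zeros of \<open>U\<close> when \<open>p \<ge> 2\<close>.
\<close>

section \<open>Orthonormal bases and the trace of a linear map\<close>

lemma orthonormal_basis_parseval:
  assumes "orthonormal_basis B"
  shows "(\<Sum>b\<in>B. (x \<bullet> b) * (y \<bullet> b)) = x \<bullet> y"
proof -
  have "y \<bullet> (\<Sum>b\<in>B. (x \<bullet> b) *\<^sub>R b) = y \<bullet> x"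
    by (simp only: orthonormal_basis_sum[OF assms])
  then show ?thesis
    by (simp add: inner_sum_right inner_commute)
qed

lemma orthonormal_basis_image:
  fixes S :: "'a::euclidean_space \<Rightarrow> 'a"
  assumes "orthogonal_transformation S" "orthonormal_basis B"
  shows "orthonormal_basis (S ` B)"
proof -
  have "span (S ` B) = UNIV"
    using assms linear_span_image[OF orthogonal_transformation_linear[OF assms(1)], of B]
      orthogonal_transformation_surj[OF assms(1)]
    by (simp add: orthonormal_basis_def)
  moreover have "pairwise orthogonal (S ` B)"
    using assms by (auto simp: orthonormal_basis_def pairwise_def orthogonal_def
        orthogonal_transformation_def)
  ultimately show ?thesis
    using assms by (auto simp: orthonormal_basis_def orthogonal_transformation_norm)
qed

text \<open>Parseval in \<open>B\<close> expands each \<open>M a \<bullet> a\<close>; after swapping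
  the sums and moving \<open>M\<close> to its adjoint, Parseval in \<open>A\<close> contracts the
  inner sum.\<close>

lemma trace_orthonormal_basis_independent:
  fixes M :: "'a::euclidean_space \<Rightarrow> 'a"
  assumes M: "linear M" and A: "orthonormal_basis A" and B: "orthonormal_basis B"
  shows "(\<Sum>a\<in>A. M a \<bullet> a) = (\<Sum>b\<in>B. M b \<bullet> b)"
proof -
  have adj: "M v \<bullet> w = adjoint M w \<bullet> v" for v w
    using adjoint_works[OF M] by (simp add: inner_commute)
  have "(\<Sum>a\<in>A. M a \<bullet> a) = (\<Sum>a\<in>A. \<Sum>b\<in>B. (M a \<bullet> b) * (a \<bullet> b))"
    by (simp add: orthonormal_basis_parseval[OF B])
  also have "\<dots> = (\<Sum>b\<in>B. \<Sum>a\<in>A. (adjoint M b \<bullet> a) * (b \<bullet> a))"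
    unfolding adj by (subst sum.swap) (simp add: inner_commute)
  also have "\<dots> = (\<Sum>b\<in>B. M b \<bullet> b)"
    by (simp add: orthonormal_basis_parseval[OF A] adj)
  finally show ?thesis .
qed

text \<open>\<open>S\<close> carries \<open>B\<close> injectively onto another orthonormal basis, so
  the left side is the trace of \<open>M\<close> computed in that image basis.\<close>

lemma trace_orthogonal_transformation:
  fixes M :: "'a::euclidean_space \<Rightarrow> 'a"
  assumes M: "linear M" and S: "orthogonal_transformation S" and B: "orthonormal_basis B"
  shows "(\<Sum>b\<in>B. M (S b) \<bullet> S b) = (\<Sum>b\<in>B. M b \<bullet> b)"
proof -
  have "inj_on S B"
    using orthogonal_transformation_inj[OF S] inj_on_subset by blast
  then have "(\<Sum>b\<in>B. M (S b) \<bullet> S b) = (\<Sum>b\<in>S ` B. M b \<bullet> b)"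
    by (simp add: sum.reindex)
  then show ?thesis
    using trace_orthonormal_basis_independent[OF M orthonormal_basis_image[OF S B] B] by simp
qed

section \<open>Differentiability of a vector field weighted by a power of its norm\<close>

lemma differentiable_norm_powr_scaleR:
  fixes U :: "'a::real_normed_vector \<Rightarrow> 'b::real_inner"
  assumes U: "U differentiable (at x)" and a: "0 \<le> a \<or> U x \<noteq> 0"
  shows "(\<lambda>y. norm (U y) powr a *\<^sub>R U y) differentiable (at x)"
proof (cases "U x = 0")
  case False
  obtain D where D: "(U has_derivative D) (at x)"
    using U by (auto simp: differentiable_def)
  have "(\<lambda>y. norm (U y)) differentiable (at x)"
    using has_derivative_compose[OF D has_derivative_norm[OF False]] by (auto simp: differentiable_def)
  then obtain N where N: "((\<lambda>y. norm (U y)) has_derivative N) (at x)"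
    by (auto simp: differentiable_def)
  have "(\<lambda>y. norm (U y) powr a) differentiable (at x)"
    using has_derivative_powr[OF N has_derivative_const[of a]] False
    by (auto simp: differentiable_def)
  then show ?thesis
    using U by (rule differentiable_scaleR)
next
  case True
  show ?thesis
  proof (cases "a = 0")
    case True
    \<comment> \<open>\<open>0 powr 0 = 0\<close> does no harm, because the factor \<open>U y\<close> then vanishes.\<close>
    then have "(\<lambda>y. norm (U y) powr a *\<^sub>R U y) = U"
      by (auto simp: fun_eq_iff)
    then show ?thesis
      using U by simp
  next
    case False
    then have a: "a > 0"
      using a \<open>U x = 0\<close> by simp
    obtain D where D: "(U has_derivative D) (at x)"
      using U by (auto simp: differentiable_def)
    obtain K where K: "K > 0" "\<And>v. norm (D v) \<le> norm v * K"
      using bounded_linear.pos_bounded[OF has_derivative_bounded_linear[OF D]] by blast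
    have "(U \<longlongrightarrow> 0) (at x)"
      using differentiable_imp_continuous_within[OF U] \<open>U x = 0\<close> by (simp add: continuous_within)
    then have "((\<lambda>y. norm (U y)) \<longlongrightarrow> 0) (at x)"
      by (rule tendsto_norm_zero)
    then have powr: "((\<lambda>y. norm (U y) powr a) \<longlongrightarrow> 0) (at x)"
      using tendsto_powr2[of "\<lambda>y. norm (U y)" 0 "at x" "\<lambda>_. a" a] a by simp
    \<comment> \<open>As \<open>U x = 0\<close>, differentiability bounds
      \<open>norm (U y) / norm (y - x)\<close> by the remainder quotient plus the constant
      \<open>K\<close> of \<open>D\<close>. This bound tends to \<open>K\<close>, and the extra
      factor \<open>norm (U y) powr a\<close> tends to 0 because \<open>a > 0\<close>.\<close>
    have "((\<lambda>y. norm (U y) powr a *\<^sub>R U y) has_derivative (\<lambda>_. 0)) (at x)"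
    proof (rule has_derivativeI_sandwich[where e = 1])
      show "bounded_linear (\<lambda>_. 0 :: 'b)" by simp
      let ?R = "\<lambda>y. norm (U y - U x - D (y - x)) / norm (y - x)"
      have R: "(?R \<longlongrightarrow> 0) (at x)"
        using D by (simp add: has_derivative_iff_norm)
      show "((\<lambda>y. norm (U y) powr a * (?R y + K)) \<longlongrightarrow> 0) (at x)"
        using tendsto_mult[OF powr tendsto_add[OF R tendsto_const[of K]]] by simp
      show "norm (norm (U y) powr a *\<^sub>R U y - norm (U x) powr a *\<^sub>R U x - 0) / norm (y - x)
          \<le> norm (U y) powr a * (?R y + K)" if "y \<noteq> x" for y
      proof -
        have "norm (U y) \<le> norm (U y - U x - D (y - x)) + norm (D (y - x))"
          using norm_triangle_ineq[of "U y - U x - D (y - x)" "D (y - x)"] \<open>U x = 0\<close> by simp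
        also have "\<dots> \<le> norm (U y - U x - D (y - x)) + norm (y - x) * K"
          using K(2) by simp
        finally have "norm (U y) / norm (y - x) \<le> ?R y + K"
          using that by (simp add: field_simps)
        then have "norm (U y) powr a * (norm (U y) / norm (y - x)) \<le> norm (U y) powr a * (?R y + K)"
          by (intro mult_left_mono) auto
        then show ?thesis
          using \<open>U x = 0\<close> by simp
      qed
    qed simp
    then show ?thesis
      by (auto simp: differentiable_def)
  qed
qed

section \<open>Locality of the horizontal derivatives\<close>

lemma twice_differentiable_at_imp_eventually_differentiable:
  assumes "twice_differentiable_at f x"
  shows "\<forall>\<^sub>F y in nhds x. f differentiable (at y)"
  using assms unfolding twice_differentiable_at_def differentiable_def
  by (auto elim: eventually_mono)

text \<open>First-order identities are available only where the function is differentiable, hence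
  only near the point; locality lets the second-order operators differentiate them
  nevertheless.\<close>

lemma partial_deriv_eventually_cong:
  assumes "\<forall>\<^sub>F y in nhds x. u y = u' y"
  shows "partial_deriv d u x = partial_deriv d u' x"
proof -
  \<comment> \<open>The filter is \<open>nhds 0\<close>, which includes \<open>t = 0\<close>, since
    a difference quotient also uses the value at the base point.\<close>
  have "((\<lambda>t. x + t *\<^sub>R d) \<longlongrightarrow> x + 0 *\<^sub>R d) (nhds 0)"
    by (intro tendsto_intros) (simp add: tendsto_ident_at filterlim_ident)
  then have "filterlim (\<lambda>t. x + t *\<^sub>R d) (nhds x) (nhds 0)"
    by simp
  then have "\<forall>\<^sub>F t in nhds 0. u (x + t *\<^sub>R d) = u' (x + t *\<^sub>R d)"
    using eventually_compose_filterlim[OF assms] by blast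
  then show ?thesis
    unfolding partial_deriv_def by (rule deriv_cong_ev) simp
qed

lemma X_field_eventually_cong:
  assumes "\<forall>\<^sub>F y in nhds x. u y = u' y"
  shows "X_field br V e u x = X_field br V e u' x"
  using partial_deriv_eventually_cong[OF assms] by (simp add: X_field_def)

section \<open>The horizontal gradient as a vector of the horizontal layer, on which
  \<open>S\<close> can act\<close>

definition hgrad :: "('h::euclidean_space \<times> 'v::euclidean_space \<Rightarrow> 'h \<times> 'v \<Rightarrow> 'h \<times> 'v)
    \<Rightarrow> 'h set \<Rightarrow> 'v set \<Rightarrow> ('h \<times> 'v \<Rightarrow> real) \<Rightarrow> 'h \<times> 'v \<Rightarrow> 'h" where
  "hgrad br E V u x = (\<Sum>e\<in>E. X_field br V e u x *\<^sub>R e)"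

text \<open>This is pure orthonormality and so holds for every function \<open>u\<close>. Directions
  outside \<open>E\<close> rely on linearity in the direction, see
  \<open>X_field_eq_hgrad\<close>.\<close>

lemma hgrad_inner_basis:
  assumes "orthonormal_basis E" "e \<in> E"
  shows "hgrad br E V u x \<bullet> e = X_field br V e u x"
proof -
  have E: "finite E" and orth: "\<And>b. b \<in> E \<Longrightarrow> b \<bullet> e = (if b = e then 1 else 0)"
    using assms pairwise_orthogonal_imp_finite
    by (auto simp: orthonormal_basis_def pairwise_def orthogonal_def norm_eq_1)
  have "hgrad br E V u x \<bullet> e = (\<Sum>b\<in>E. if b = e then X_field br V b u x else 0)"
    unfolding hgrad_def inner_sum_left by (rule sum.cong) (auto simp: orth)
  then show ?thesis
    using E assms(2) by simp
qed

lemma hgrad_inner_eq: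
  assumes "orthonormal_basis E"
  shows "hgrad_inner br E V F u x = hgrad br E V F x \<bullet> hgrad br E V u x"
proof -
  have "hgrad_inner br E V F u x = (\<Sum>e\<in>E. (hgrad br E V F x \<bullet> e) * (hgrad br E V u x \<bullet> e))"
    unfolding hgrad_inner_def by (rule sum.cong) (simp_all add: hgrad_inner_basis[OF assms])
  then show ?thesis
    by (simp only: orthonormal_basis_parseval[OF assms])
qed

lemma hgrad_norm_eq:
  assumes "orthonormal_basis E"
  shows "hgrad_norm br E V u x = norm (hgrad br E V u x)"
proof -
  have "(\<Sum>e\<in>E. (X_field br V e u x)\<^sup>2) = hgrad br E V u x \<bullet> hgrad br E V u x"
    unfolding hgrad_inner_eq[OF assms, symmetric] by (simp add: hgrad_inner_def power2_eq_square)
  then show ?thesis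
    by (simp add: hgrad_norm_def norm_eq_sqrt_inner)
qed

lemma p_flux_eq:
  assumes "orthonormal_basis E" "e \<in> E"
  shows "p_flux br E V p u e x
    = (norm (hgrad br E V u x) powr (p - 2) *\<^sub>R hgrad br E V u x) \<bullet> e"
  by (simp add: p_flux_def hgrad_norm_eq[OF assms(1)] hgrad_inner_basis[OF assms])

text \<open>Divergence form, to which \<open>hdiv_horizontal_map\<close> applies.\<close>

lemma hlaplacian_eq_div:
  assumes "orthonormal_basis E"
  shows "hlaplacian br E V u x = (\<Sum>e\<in>E. X_field br V e (\<lambda>y. hgrad br E V u y \<bullet> e) x)"
  by (simp add: hlaplacian_def hgrad_inner_basis[OF assms])

lemma hp_laplacian_eq_div:
  assumes "orthonormal_basis E"
  shows "hp_laplacian br E V p u x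
    = (\<Sum>e\<in>E. X_field br V e
        (\<lambda>y. (norm (hgrad br E V u y) powr (p - 2) *\<^sub>R hgrad br E V u y) \<bullet> e) x)"
proof -
  \<comment> \<open>An equality of functions is required, because \<open>X_field\<close>
    differentiates the flux.\<close>
  have "p_flux br E V p u e = (\<lambda>y. (norm (hgrad br E V u y) powr (p - 2) *\<^sub>R hgrad br E V u y) \<bullet> e)"
    if "e \<in> E" for e
    using p_flux_eq[OF assms that] by blast
  then show ?thesis
    unfolding hp_laplacian_def by (intro sum.cong) simp_all
qed

lemma differentiable_orthonormal_components:
  fixes W :: "'a::real_normed_vector \<Rightarrow> 'b::euclidean_space"
  assumes B: "orthonormal_basis B" and "\<And>b. b \<in> B \<Longrightarrow> (\<lambda>y. W y \<bullet> b) differentiable (at x)"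
  shows "W differentiable (at x)"
proof -
  have "finite B"
    using B pairwise_orthogonal_imp_finite by (auto simp: orthonormal_basis_def)
  then have "(\<lambda>y. \<Sum>b\<in>B. (W y \<bullet> b) *\<^sub>R b) differentiable (at x)"
    using assms(2) by (auto intro!: differentiable_sum differentiable_scaleR)
  then show ?thesis
    by (simp add: orthonormal_basis_sum[OF B])
qed

section \<open>The linear map of the group induced by \<open>S\<close>\<close>

definition horizontal_map :: "('h \<Rightarrow> 'h) \<Rightarrow> 'h \<times> 'v \<Rightarrow> 'h \<times> 'v" where
  "horizontal_map S x = (S (fst x), snd x)"

lemma bounded_linear_horizontal_map:
  fixes S :: "'h::euclidean_space \<Rightarrow> 'h"
  assumes "orthogonal_transformation S"
  shows "bounded_linear (horizontal_map S :: 'h \<times> 'v::euclidean_space \<Rightarrow> 'h \<times> 'v)"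
proof -
  have "bounded_linear S"
    using orthogonal_transformation_linear[OF assms] by (simp add: linear_conv_bounded_linear)
  then show ?thesis
    unfolding horizontal_map_def
    by (intro bounded_linear_Pair bounded_linear_snd)
      (rule bounded_linear_compose[OF _ bounded_linear_fst])
qed

lemma has_derivative_horizontal_map:
  fixes S :: "'h::euclidean_space \<Rightarrow> 'h"
  assumes "orthogonal_transformation S"
  shows "(horizontal_map S has_derivative (horizontal_map S :: 'h \<times> 'v::euclidean_space \<Rightarrow> _)) (at x)"
  by (rule bounded_linear_imp_has_derivative[OF bounded_linear_horizontal_map[OF assms]])

lemma filterlim_horizontal_map:
  fixes S :: "'h::euclidean_space \<Rightarrow> 'h" and x :: "'h \<times> 'v::euclidean_space"
  assumes "orthogonal_transformation S"
  shows "filterlim (horizontal_map S) (nhds (horizontal_map S x)) (nhds x)"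
  using has_derivative_continuous[OF has_derivative_horizontal_map[OF assms]]
  by (metis continuous_at tendsto_at_iff_tendsto_nhds)

section \<open>Equivariance of the bracket, the fields, the gradient and the divergence\<close>

context heisenberg_type
begin

lemma J_orthogonal_group_orthogonal:
  assumes "S \<in> J_orthogonal_group br"
  shows "orthogonal_transformation S"
  using assms by (simp add: J_orthogonal_group_def)

text \<open>Pairing the bracket with \<tau> gives \<open>J_map br \<tau> (S v) \<bullet> S w = S
  (J_map br \<tau> v) \<bullet> S w = J_map br \<tau> v \<bullet> w\<close>, by commutation with
  \<open>J\<close> and then orthogonality. The bracket is vertical, so these pairings determine
  it.\<close>

lemma br_horizontal_map:
  assumes S: "S \<in> J_orthogonal_group br"
  shows "br (horizontal_map S x) (horizontal_map S y) = br x y"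
proof -
  have S_inner: "S v \<bullet> S w = v \<bullet> w" for v w
    using J_orthogonal_group_orthogonal[OF S] by (simp add: orthogonal_transformation_def)
  have "J_map br \<tau> (S v) = S (J_map br \<tau> v)" for \<tau> v
    using S by (auto simp: J_orthogonal_group_def fun_eq_iff)
  then have "br (S v, 0) (S w, 0) \<bullet> (0, \<tau>) = br (v, 0) (w, 0) \<bullet> (0, \<tau>)" for v w \<tau>
    using J_map_inner[of \<tau> "S v" "S w"] J_map_inner[of \<tau> v w] by (simp add: S_inner)
  then have "snd (br (S v, 0) (S w, 0)) \<bullet> \<tau> = snd (br (v, 0) (w, 0)) \<bullet> \<tau>" for v w \<tau>
    by (simp add: inner_prod_def)
  then have "snd (br (S v, 0) (S w, 0)) = snd (br (v, 0) (w, 0))" for v w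
    using vector_eq_rdot by blast
  then have "br (S v, 0) (S w, 0) = br (v, 0) (w, 0)" for v w
    by (simp add: prod_eq_iff fst_br)
  then show ?thesis
    using br_horizontal[of "S (fst x)" "snd x" "S (fst y)" "snd y"]
      br_horizontal[of "fst x" "snd x" "fst y" "snd y"]
    by (simp add: horizontal_map_def)
qed

text \<open>The bracket term is vertical, where \<open>horizontal_map S\<close> is the identity, and
  \<open>br_horizontal_map\<close> moves it to the image point. By \<open>X_field_eq\<close> these
  vectors are the directions of differentiation, so this is the intertwining of the fields at the
  level of vectors.\<close>

lemma horizontal_map_frame:
  assumes S: "S \<in> J_orthogonal_group br"
  shows "horizontal_map S ((v, 0) + (1/2) *\<^sub>R br x (v, 0))
    = (S v, 0) + (1/2) *\<^sub>R br (horizontal_map S x) (S v, 0)"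
proof -
  have S0: "S 0 = 0"
    using J_orthogonal_group_orthogonal[OF S] orthogonal_transformation_linear linear_0 by blast
  have "br (horizontal_map S x) (S v, 0) = br x (v, 0)"
    using br_horizontal_map[OF S, of x "(v, 0)"] by (simp add: horizontal_map_def)
  then show ?thesis
    by (simp add: horizontal_map_def prod_eq_iff fst_br)
qed

text \<open>By the chain rule the left side is \<open>D\<close> applied to the image of the
  direction of \<open>v\<close> at \<open>x\<close>, which \<open>horizontal_map_frame\<close>
  computes.\<close>

lemma X_field_horizontal_map:
  assumes V: "orthonormal_basis V" and S: "S \<in> J_orthogonal_group br"
    and u: "u differentiable (at (horizontal_map S x))"
  shows "X_field br V v (\<lambda>y. u (horizontal_map S y)) x = X_field br V (S v) u (horizontal_map S x)"
proof -
  obtain D where D: "(u has_derivative D) (at (horizontal_map S x))"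
    using u by (auto simp: differentiable_def)
  have "((\<lambda>y. u (horizontal_map S y)) has_derivative (\<lambda>d. D (horizontal_map S d))) (at x)"
    using has_derivative_compose[OF
        has_derivative_horizontal_map[OF J_orthogonal_group_orthogonal[OF S]] D] .
  then show ?thesis
    using X_field_eq[OF V] D by (simp add: horizontal_map_frame[OF S])
qed

lemma linear_frame: "linear (\<lambda>v. (v, 0) + (1/2) *\<^sub>R br x (v, 0))"
proof -
  have "linear (\<lambda>v :: 'h. (v, 0 :: 'v))"
    by (simp add: linear_iff)
  moreover from this have "linear (\<lambda>v. br x (v, 0))"
    using linear_compose linear_br(1)[of x] by (force simp: o_def)
  ultimately show ?thesis
    by (intro linear_compose_add linear_compose_scale_right)
qed

text \<open>Differentiability makes \<open>X_field\<close> linear in its direction, so expanding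
  \<open>v\<close> in \<open>E\<close> suffices. The case of interest is \<open>S v\<close>, which
  need not lie in \<open>E\<close>.\<close>

lemma X_field_eq_hgrad:
  assumes E: "orthonormal_basis E" and V: "orthonormal_basis V" and u: "u differentiable (at x)"
  shows "X_field br V v u x = hgrad br E V u x \<bullet> v"
proof -
  obtain D where D: "(u has_derivative D) (at x)"
    using u by (auto simp: differentiable_def)
  have lin: "linear (\<lambda>v. X_field br V v u x)"
    using linear_compose[OF linear_frame has_derivative_linear[OF D]]
    by (simp add: X_field_eq[OF V D] o_def)
  have "X_field br V v u x = X_field br V (\<Sum>e\<in>E. (v \<bullet> e) *\<^sub>R e) u x"
    by (simp add: orthonormal_basis_sum[OF E])
  also have "\<dots> = (\<Sum>e\<in>E. (v \<bullet> e) * X_field br V e u x)"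
    by (simp add: linear_sum[OF lin] linear_scale[OF lin])
  also have "\<dots> = hgrad br E V u x \<bullet> v"
    by (simp add: hgrad_def inner_sum_left inner_commute[of v] mult.commute)
  finally show ?thesis .
qed

text \<open>Intertwining of the fields gives \<open>?a \<bullet> v = ?b \<bullet> S v\<close>, while
  orthogonality gives \<open>?a \<bullet> v = S ?a \<bullet> S v\<close>. As \<open>S\<close> is
  onto, \<open>S ?a\<close> and \<open>?b\<close> have the same inner products with all
  vectors.\<close>

lemma hgrad_horizontal_map:
  assumes E: "orthonormal_basis E" and V: "orthonormal_basis V"
    and S: "S \<in> J_orthogonal_group br" and u: "u differentiable (at (horizontal_map S x))"
  shows "S (hgrad br E V (\<lambda>y. u (horizontal_map S y)) x) = hgrad br E V u (horizontal_map S x)"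
    (is "S ?a = ?b")
proof -
  have orth: "orthogonal_transformation S"
    using S by (rule J_orthogonal_group_orthogonal)
  have "(\<lambda>y. u (horizontal_map S y)) differentiable (at x)"
    using u has_derivative_compose[OF has_derivative_horizontal_map[OF orth]]
    unfolding differentiable_def by blast
  then have "?a \<bullet> v = ?b \<bullet> S v" for v
    using X_field_horizontal_map[OF V S u, of v]
    by (simp add: X_field_eq_hgrad[OF E V] u)
  moreover have "?a \<bullet> v = S ?a \<bullet> S v" for v
    using orth by (simp add: orthogonal_transformation_def)
  ultimately have "S ?a \<bullet> w = ?b \<bullet> w" for w
    using orthogonal_transformation_surj[OF orth] by (metis surjD)
  then show ?thesis
    using vector_eq_rdot by blast
qed

text \<open>Near \<open>x\<close>, each component is \<open>f' y\<close> applied to a direction that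
  is affine in \<open>y\<close>; the product rule for this bilinear evaluation applies because
  \<open>f'\<close> is differentiable at \<open>x\<close>.\<close>

lemma differentiable_hgrad:
  assumes E: "orthonormal_basis E" and V: "orthonormal_basis V"
    and f: "twice_differentiable_at f x"
  shows "hgrad br E V f differentiable (at x)"
proof (rule differentiable_orthonormal_components[OF E])
  fix e assume e: "e \<in> E"
  obtain f' where f': "\<forall>\<^sub>F y in nhds x. (f has_derivative blinfun_apply (f' y)) (at y)"
    and diff: "f' differentiable (at x)"
    using f unfolding twice_differentiable_at_def by blast
  obtain D where D: "(f' has_derivative D) (at x)"
    using diff by (auto simp: differentiable_def)
  have "bounded_linear (\<lambda>y. br y (e, 0))"
    using linear_br(2) by (simp add: linear_conv_bounded_linear)
  then have "((\<lambda>y. br y (e, 0)) has_derivative (\<lambda>y. br y (e, 0))) (at x)"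
    by (rule bounded_linear_imp_has_derivative)
  then have "((\<lambda>y. (e, 0) + (1/2) *\<^sub>R br y (e, 0)) has_derivative (\<lambda>y. (1/2) *\<^sub>R br y (e, 0))) (at x)"
    by (auto intro!: derivative_eq_intros)
  from bounded_bilinear.FDERIV[OF bounded_bilinear_blinfun_apply D this]
  have "(\<lambda>y. f' y ((e, 0) + (1/2) *\<^sub>R br y (e, 0))) differentiable (at x)"
    unfolding differentiable_def by blast
  then obtain D' where D': "((\<lambda>y. f' y ((e, 0) + (1/2) *\<^sub>R br y (e, 0))) has_derivative D') (at x)"
    by (auto simp: differentiable_def)
  have ev: "\<forall>\<^sub>F y in nhds x. f' y ((e, 0) + (1/2) *\<^sub>R br y (e, 0)) = hgrad br E V f y \<bullet> e"
    using f' by eventually_elim (simp add: hgrad_inner_basis[OF E e] X_field_eq[OF V])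
  have "((\<lambda>y. hgrad br E V f y \<bullet> e) has_derivative D') (at x)"
  proof (rule has_derivative_transform_eventually[OF D'])
    show "\<forall>\<^sub>F y in at x. f' y ((e, 0) + (1/2) *\<^sub>R br y (e, 0)) = hgrad br E V f y \<bullet> e"
      using ev by (auto simp: eventually_at_filter elim: eventually_mono)
    show "f' x ((e, 0) + (1/2) *\<^sub>R br x (e, 0)) = hgrad br E V f x \<bullet> e"
      by (rule eventually_nhds_x_imp_x[OF ev])
  qed simp
  then show "(\<lambda>y. hgrad br E V f y \<bullet> e) differentiable (at x)"
    by (auto simp: differentiable_def)
qed

text \<open>Both sums are traces of one linear map, on the right in \<open>E\<close> and on the left
  in its image under \<open>S\<close>: the chain rule turns the direction \<open>e\<close> into
  \<open>S e\<close>, matching the component already taken along \<open>S e\<close>.\<close>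

lemma hdiv_horizontal_map:
  assumes E: "orthonormal_basis E" and V: "orthonormal_basis V"
    and S: "S \<in> J_orthogonal_group br" and W: "W differentiable (at (horizontal_map S x))"
  shows "(\<Sum>e\<in>E. X_field br V e (\<lambda>y. W (horizontal_map S y) \<bullet> S e) x)
    = (\<Sum>e\<in>E. X_field br V e (\<lambda>y. W y \<bullet> e) (horizontal_map S x))"
proof -
  let ?x = "horizontal_map S x"
  obtain D where D: "(W has_derivative D) (at ?x)"
    using W by (auto simp: differentiable_def)
  \<comment> \<open>\<open>M v\<close> is the derivative of \<open>W\<close> at the image point
    along the direction of \<open>X_field\<close> for \<open>v\<close>.\<close>
  define M where "M v = D ((v, 0) + (1/2) *\<^sub>R br ?x (v, 0))" for v
  have "linear M"
    using linear_compose[OF linear_frame has_derivative_linear[OF D]] by (simp add: M_def[abs_def] o_def)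
  have Wv: "((\<lambda>y. W y \<bullet> v) has_derivative (\<lambda>d. D d \<bullet> v)) (at ?x)" for v
    using D by (rule has_derivative_inner_left)
  have M: "X_field br V w (\<lambda>y. W y \<bullet> v) ?x = M w \<bullet> v" for v w
    using X_field_eq[OF V Wv, of w v] by (simp add: M_def)
  have "X_field br V e (\<lambda>y. W (horizontal_map S y) \<bullet> S e) x = M (S e) \<bullet> S e" for e
    using X_field_horizontal_map[OF V S, of "\<lambda>y. W y \<bullet> S e" x e] Wv
    by (auto simp: differentiable_def M)
  then show ?thesis
    using trace_orthogonal_transformation[OF \<open>linear M\<close> J_orthogonal_group_orthogonal[OF S] E]
    by (simp add: M)
qed

end

section \<open>Invariance of the three operators\<close>

theorem proposition1p3:
  fixes br :: "'h::euclidean_space \<times> 'v::euclidean_space \<Rightarrow> 'h \<times> 'v \<Rightarrow> 'h \<times> 'v"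
    and E :: "'h set" and V :: "'v set"
    and S :: "'h \<Rightarrow> 'h"
    and f g :: "'h \<times> 'v \<Rightarrow> real"
    and z :: 'h and \<sigma> :: 'v
  assumes "heisenberg_type br"
    and "orthonormal_basis E" and "orthonormal_basis V"
    and "S \<in> J_orthogonal_group br"
    and "\<And>w \<tau>. g (w, \<tau>) = f (S w, \<tau>)"
    and "twice_differentiable_at f (S z, \<sigma>)"
  shows "hlaplacian br E V g (z, \<sigma>) = hlaplacian br E V f (S z, \<sigma>)
    \<and> hinf_laplacian br E V g (z, \<sigma>) = hinf_laplacian br E V f (S z, \<sigma>)
    \<and> (\<forall>p::real. 1 < p \<and>
          (2 \<le> p \<or> hgrad_norm br E V f (S z, \<sigma>) \<noteq> 0
           \<or> (\<forall>e\<in>E. p_flux br E V p f e differentiable (at (S z, \<sigma>))))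
        \<longrightarrow> hp_laplacian br E V p g (z, \<sigma>) = hp_laplacian br E V p f (S z, \<sigma>))"
proof -
  interpret heisenberg_type br by fact
  note E = assms(2) and V = assms(3) and S = assms(4)
  let ?\<phi> = "horizontal_map S"
  let ?x = "(z, \<sigma>)"
  let ?G = "hgrad br E V f"
  have g: "g = (\<lambda>y. f (?\<phi> y))"
    using assms(5) by (auto simp: horizontal_map_def fun_eq_iff)
  have x: "(S z, \<sigma>) = ?\<phi> ?x"
    by (simp add: horizontal_map_def)
  have orth: "orthogonal_transformation S"
    using S by (rule J_orthogonal_group_orthogonal)
  have f2: "twice_differentiable_at f (?\<phi> ?x)"
    using assms(6) by (simp add: x)
  have G: "?G differentiable (at (?\<phi> ?x))"
    using E V f2 by (rule differentiable_hgrad)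
  \<comment> \<open>Continuity pulls differentiability back from the image point, so the gradient
    identity \<open>g_ev\<close> holds on a whole neighbourhood and can be differentiated.\<close>
  have f_ev: "\<forall>\<^sub>F y in nhds ?x. f differentiable (at (?\<phi> y))"
    using eventually_compose_filterlim[OF twice_differentiable_at_imp_eventually_differentiable[OF f2]
        filterlim_horizontal_map[OF orth]] .
  then have g_ev: "\<forall>\<^sub>F y in nhds ?x. S (hgrad br E V g y) = ?G (?\<phi> y)"
    by eventually_elim (simp add: g hgrad_horizontal_map[OF E V S])
  have S_inner: "S v \<bullet> S w = v \<bullet> w" and S_norm: "norm (S v) = norm v" for v w
    using orth by (simp_all add: orthogonal_transformation_def orthogonal_transformation_norm)

  \<comment> \<open>Orthogonality replaces the component along \<open>e\<close> of the gradient of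
    \<open>g\<close> by the component along \<open>S e\<close> of its image under \<open>S\<close>,
    which is \<open>?G (?\<phi> y)\<close> near the point.\<close>
  have "hlaplacian br E V g ?x = (\<Sum>e\<in>E. X_field br V e (\<lambda>y. ?G (?\<phi> y) \<bullet> S e) ?x)"
    unfolding hlaplacian_eq_div[OF E]
    by (intro sum.cong refl X_field_eventually_cong eventually_mono[OF g_ev]) (metis S_inner)
  then have lap: "hlaplacian br E V g ?x = hlaplacian br E V f (?\<phi> ?x)"
    by (simp add: hdiv_horizontal_map[OF E V S G] hlaplacian_eq_div[OF E])

  let ?N = "\<lambda>y. (hgrad_norm br E V f y)\<^sup>2"
  have N: "?N differentiable (at (?\<phi> ?x))"
  proof -
    \<comment> \<open>\<open>?N\<close> is the inner product of \<open>?G\<close> with itself, so no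
      root has to be differentiated and critical points are harmless.\<close>
    obtain D where "(?G has_derivative D) (at (?\<phi> ?x))"
      using G by (auto simp: differentiable_def)
    from has_derivative_inner[OF this this] show ?thesis
      by (auto simp: differentiable_def hgrad_norm_eq[OF E] power2_norm_eq_inner)
  qed
  have N_ev: "\<forall>\<^sub>F y in nhds ?x. (hgrad_norm br E V g y)\<^sup>2 = ?N (?\<phi> y)"
    using g_ev by eventually_elim (metis S_norm hgrad_norm_eq[OF E])
  \<comment> \<open>The squared gradient norm of \<open>g\<close> is locally \<open>?N\<close>
    composed with \<open>?\<phi>\<close>, so its gradient rotates like that of \<open>g\<close>;
    \<open>S\<close> then preserves their inner product.\<close>
  have "hgrad br E V (\<lambda>y. (hgrad_norm br E V g y)\<^sup>2) ?x = hgrad br E V (\<lambda>y. ?N (?\<phi> y)) ?x"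
    unfolding hgrad_def by (simp only: X_field_eventually_cong[OF N_ev])
  then have "S (hgrad br E V (\<lambda>y. (hgrad_norm br E V g y)\<^sup>2) ?x) = hgrad br E V ?N (?\<phi> ?x)"
    using hgrad_horizontal_map[OF E V S N] by simp
  then have inf: "hinf_laplacian br E V g ?x = hinf_laplacian br E V f (?\<phi> ?x)"
    using eventually_nhds_x_imp_x[OF g_ev]
    by (simp add: hinf_laplacian_def hgrad_inner_eq[OF E]) (metis S_inner)

  have p_lap: "hp_laplacian br E V p g ?x = hp_laplacian br E V p f (?\<phi> ?x)"
    if p: "2 \<le> p \<or> hgrad_norm br E V f (?\<phi> ?x) \<noteq> 0
      \<or> (\<forall>e\<in>E. p_flux br E V p f e differentiable (at (?\<phi> ?x)))" for p
  proof -
    let ?W = "\<lambda>y. norm (?G y) powr (p - 2) *\<^sub>R ?G y"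
    \<comment> \<open>The first two alternatives give this by
      \<open>differentiable_norm_powr_scaleR\<close>. The third provides it componentwise and covers
      critical points with \<open>p < 2\<close>.\<close>
    have W: "?W differentiable (at (?\<phi> ?x))"
    proof (cases "2 \<le> p \<or> hgrad_norm br E V f (?\<phi> ?x) \<noteq> 0")
      case True
      then show ?thesis
        by (intro differentiable_norm_powr_scaleR[OF G]) (auto simp: hgrad_norm_eq[OF E])
    next
      case False
      show ?thesis
      proof (rule differentiable_orthonormal_components[OF E])
        fix e assume e: "e \<in> E"
        then have "p_flux br E V p f e = (\<lambda>y. ?W y \<bullet> e)"
          by (intro ext p_flux_eq[OF E])
        then show "(\<lambda>y. ?W y \<bullet> e) differentiable (at (?\<phi> ?x))"
          using p False e by metis
      qed
    qed
    \<comment> \<open>\<open>S\<close> preserves norms, so the weight for \<open>g\<close> at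
      \<open>y\<close> equals that for \<open>f\<close> at \<open>?\<phi> y\<close>; the vector
      factor is treated as for the Laplacian.\<close>
    have "hp_laplacian br E V p g ?x = (\<Sum>e\<in>E. X_field br V e (\<lambda>y. ?W (?\<phi> y) \<bullet> S e) ?x)"
      unfolding hp_laplacian_eq_div[OF E]
      by (intro sum.cong refl X_field_eventually_cong eventually_mono[OF g_ev])
        (metis S_inner S_norm inner_scaleR_left)
    then show ?thesis
      by (simp only: hdiv_horizontal_map[OF E V S W] hp_laplacian_eq_div[OF E])
  qed
  show ?thesis
    using lap inf p_lap by (simp add: x)
qed

end
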